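(* Let $\overline{x}\in\mathbb{R}^n$ and let $F:\mathbb{R}^n\rightrightarrows\mathbb{R}^n$ be a set-valued mapping. Suppose: (i) $f:\mathbb{R}^n\to\mathbb{R}$ is a (locally Lipschitz) potential of a conservative field $D:\mathbb{R}^n\rightrightarrows\mathbb{R}^n$ such that $$\forall x\in\mathbb{R}^n,\quad \sup_{u\in F(x)}\ \min_{v\in D(x)}\langle u,v\rangle\leq 0;$$ (ii) $\overline{x}$ is a strict local minimum of $f$. Then $\overline{x}$ is (Lyapunov) stable for $F$.
   Context: $|\cdot|=\sqrt{\langle\cdot,\cdot\rangle}$ is the Euclidean norm and $B_r(\overline{x})$ is the open ball of radius $r$ centered at $\overline{x}$. Conservative field: given a locally Lipschitz function $f:\mathbb{R}^n\to\mathbb{R}$, a set-valued map $D:\mathbb{R}^n\rightrightarrows\mathbb{R}^n$ is a conservative field for $f$ (and $f$ is called a potential of $D$) if $D$ has a closed graph, nonempty compact values, and for every absolutely continuous curve $x:[0,1]\to\mathbb{R}^n$, for almost every $t\in(0,1)$ and for all $v\in D(x(t))$, $(f\circ x)'(t)=\langle v,x'(t)\rangle$. Stability: $\overline{x}$ is (Lyapunov) stable for $F$ if for every $\epsilon>0$ there exists $\delta>0$ such that, for every $T\in(0,\infty]$ and every absolutely continuous curve $x:[0,T)\to\mathbb{R}^n$ with $x'(t)\in F(x(t))$ for almost every $t\in(0,T)$, if $x(0)\in B_\delta(\overline{x})$ then $x([0,T))\subseteq B_\epsilon(\overline{x})$. The supremum over an empty set is $-\infty$. *)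

theory Defs
  imports "HOL-Analysis.Analysis"
begin

definition locally_lipschitz :: "('a::metric_space \<Rightarrow> 'b::metric_space) \<Rightarrow> bool" where
  "locally_lipschitz f \<longleftrightarrow> (\<forall>x. \<exists>r>0. \<exists>L. L-lipschitz_on (ball x r) f)"

(* A pair (a, b) in P encodes the interval with endpoints a and b. Pairs with a = b are
   harmless: their open interval is empty and they contribute 0 to both sums. *)
definition abs_cont_on_segment :: "real \<Rightarrow> real \<Rightarrow> (real \<Rightarrow> 'a::real_normed_vector) \<Rightarrow> bool" where
  "abs_cont_on_segment c d x \<longleftrightarrow>
     (\<forall>\<epsilon>>0. \<exists>\<delta>>0. \<forall>P. finite P \<longrightarrow>
        (\<forall>(a, b)\<in>P. c \<le> a \<and> a \<le> b \<and> b \<le> d) \<longrightarrow>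
        disjoint_family_on (\<lambda>(a, b). {a<..<b}) P \<longrightarrow>
        (\<Sum>(a, b)\<in>P. b - a) < \<delta> \<longrightarrow>
        (\<Sum>(a, b)\<in>P. norm (x b - x a)) < \<epsilon>)"

(* On a noncompact interval, absolute continuity means absolute continuity on every compact
   subinterval; on a compact interval this is the usual epsilon-delta notion. *)
definition abs_cont_on :: "real set \<Rightarrow> (real \<Rightarrow> 'a::real_normed_vector) \<Rightarrow> bool" where
  "abs_cont_on I x \<longleftrightarrow> (\<forall>c d. c \<le> d \<longrightarrow> {c..d} \<subseteq> I \<longrightarrow> abs_cont_on_segment c d x)"

(* Set-valued maps are functions into sets, with possibly empty values. An identity between
   derivatives includes the existence of those derivatives. *)
definition conservative_field ::
  "('a::euclidean_space \<Rightarrow> 'a set) \<Rightarrow> ('a \<Rightarrow> real) \<Rightarrow> bool" where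
  "conservative_field D f \<longleftrightarrow>
     locally_lipschitz f \<and>
     closed {(x, v). v \<in> D x} \<and>
     (\<forall>x. D x \<noteq> {} \<and> compact (D x)) \<and>
     (\<forall>x :: real \<Rightarrow> 'a. abs_cont_on {0..1} x \<longrightarrow>
        (AE t in lebesgue. t \<in> {0<..<1} \<longrightarrow>
           (\<exists>x'. (x has_vector_derivative x') (at t) \<and>
              (\<forall>v\<in>D (x t). ((f \<circ> x) has_real_derivative (v \<bullet> x')) (at t)))))"

(* Values of x outside [0, T) are irrelevant: 0 < t < T is an interior point of the interval. *)
definition solution_on :: "('a::euclidean_space \<Rightarrow> 'a set) \<Rightarrow> ereal \<Rightarrow> (real \<Rightarrow> 'a) \<Rightarrow> bool" where
  "solution_on F T x \<longleftrightarrow>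
     abs_cont_on {t. 0 \<le> t \<and> ereal t < T} x \<and>
     (AE t in lebesgue. 0 < t \<and> ereal t < T \<longrightarrow>
        (\<exists>x'. (x has_vector_derivative x') (at t) \<and> x' \<in> F (x t)))"

definition lyapunov_stable :: "('a::euclidean_space \<Rightarrow> 'a set) \<Rightarrow> 'a \<Rightarrow> bool" where
  "lyapunov_stable F xb \<longleftrightarrow>
     (\<forall>\<epsilon>>0. \<exists>\<delta>>0. \<forall>(T::ereal) x. 0 < T \<longrightarrow> solution_on F T x \<longrightarrow>
        x 0 \<in> ball xb \<delta> \<longrightarrow> x ` {t. 0 \<le> t \<and> ereal t < T} \<subseteq> ball xb \<epsilon>)"

definition strict_local_minimum :: "('a::metric_space \<Rightarrow> real) \<Rightarrow> 'a \<Rightarrow> bool" where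
  "strict_local_minimum f xb \<longleftrightarrow> (\<exists>r>0. \<forall>x\<in>ball xb r. x \<noteq> xb \<longrightarrow> f xb < f x)"

(* The minimum of an arbitrary set of reals, whenever it is attained (Min is restricted to
   finite sets). *)
definition minimum :: "real set \<Rightarrow> real" where
  "minimum S = (LEAST r. r \<in> S)"

end

(* Along a solution x, the potential is an absolutely continuous function of time, and for
   almost every t the number (f o x)'(t) = <v, x'(t)> does not depend on v in D(x(t)); choosing
   the minimizing v makes it nonpositive, so f decreases along x. A solution that starts near xb,
   where f is smaller than its minimum on a small sphere around xb, can never reach that sphere. *)
theory Submission
  imports Defs
begin

section \<open>Absolutely continuous curves on compact intervals\<close>

lemma abs_cont_on_segment_subset:
  assumes "abs_cont_on_segment c d x" "c \<le> c'" "d' \<le> d"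
  shows "abs_cont_on_segment c' d' x"
  unfolding abs_cont_on_segment_def
proof (intro allI impI)
  fix e :: real assume "e > 0"
  then obtain \<delta> where "\<delta> > 0" and \<delta>: "\<And>P. finite P \<Longrightarrow>
        (\<forall>(a, b)\<in>P. c \<le> a \<and> a \<le> b \<and> b \<le> d) \<Longrightarrow>
        disjoint_family_on (\<lambda>(a, b). {a<..<b}) P \<Longrightarrow>
        (\<Sum>(a, b)\<in>P. b - a) < \<delta> \<Longrightarrow> (\<Sum>(a, b)\<in>P. norm (x b - x a)) < e"
    using assms(1) unfolding abs_cont_on_segment_def by meson
  show "\<exists>\<delta>>0. \<forall>P. finite P \<longrightarrow>
        (\<forall>(a, b)\<in>P. c' \<le> a \<and> a \<le> b \<and> b \<le> d') \<longrightarrow>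
        disjoint_family_on (\<lambda>(a, b). {a<..<b}) P \<longrightarrow>
        (\<Sum>(a, b)\<in>P. b - a) < \<delta> \<longrightarrow> (\<Sum>(a, b)\<in>P. norm (x b - x a)) < e"
  proof (intro exI[of _ \<delta>] conjI \<open>\<delta> > 0\<close> allI impI)
    fix P :: "(real \<times> real) set"
    assume P: "finite P" "\<forall>(a, b)\<in>P. c' \<le> a \<and> a \<le> b \<and> b \<le> d'"
      "disjoint_family_on (\<lambda>(a, b). {a<..<b}) P" "(\<Sum>(a, b)\<in>P. b - a) < \<delta>"
    show "(\<Sum>(a, b)\<in>P. norm (x b - x a)) < e"
    proof (rule \<delta>[OF P(1) _ P(3,4)])
      show "\<forall>(a, b)\<in>P. c \<le> a \<and> a \<le> b \<and> b \<le> d"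
        using P(2) assms(2,3) by fastforce
    qed
  qed
qed

lemma abs_cont_on_segment_imp_continuous_on:
  fixes x :: "real \<Rightarrow> 'a::real_normed_vector"
  assumes "abs_cont_on_segment c d x"
  shows "continuous_on {c..d} x"
  unfolding continuous_on_iff
proof (intro ballI allI impI)
  fix s e :: real assume s: "s \<in> {c..d}" and "e > 0"
  then obtain \<delta> where "\<delta> > 0" and \<delta>: "\<And>P. finite P \<Longrightarrow>
        (\<forall>(a, b)\<in>P. c \<le> a \<and> a \<le> b \<and> b \<le> d) \<Longrightarrow>
        disjoint_family_on (\<lambda>(a, b). {a<..<b}) P \<Longrightarrow>
        (\<Sum>(a, b)\<in>P. b - a) < \<delta> \<Longrightarrow> (\<Sum>(a, b)\<in>P. norm (x b - x a)) < e"
    using assms(1) unfolding abs_cont_on_segment_def by meson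
  have step: "norm (x v - x u) < e" if "c \<le> u" "u \<le> v" "v \<le> d" "v - u < \<delta>" for u v
    using \<delta>[of "{(u, v)}"] that by (simp add: disjoint_family_on_def)
  show "\<exists>\<delta>>0. \<forall>t\<in>{c..d}. dist t s < \<delta> \<longrightarrow> dist (x t) (x s) < e"
  proof (intro exI[of _ \<delta>] conjI \<open>\<delta> > 0\<close> ballI impI)
    fix t assume t: "t \<in> {c..d}" "dist t s < \<delta>"
    show "dist (x t) (x s) < e"
    proof (cases "s \<le> t")
      case True
      with step[of s t] s t show ?thesis by (simp add: dist_norm)
    next
      case False
      with step[of t s] s t show ?thesis by (simp add: dist_norm norm_minus_commute)
    qed
  qed
qed

text \<open>Conservative fields test only curves on the unit interval, whereas solutions are
  followed up to an arbitrary time; this change of time links the two. Multiplication by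
  \<open>k\<close> scales total lengths by \<open>k\<close>, so \<open>\<delta> / k\<close> serves
  as the new threshold.\<close>

lemma abs_cont_on_segment_rescale:
  fixes x :: "real \<Rightarrow> 'a::real_normed_vector"
  assumes ac: "abs_cont_on_segment (k * c) (k * d) x" and k: "k > 0"
  shows "abs_cont_on_segment c d (\<lambda>s. x (k * s))"
  unfolding abs_cont_on_segment_def
proof (intro allI impI)
  fix e :: real assume "e > 0"
  then obtain \<delta> where "\<delta> > 0" and \<delta>: "\<And>P. finite P \<Longrightarrow>
        (\<forall>(a, b)\<in>P. k * c \<le> a \<and> a \<le> b \<and> b \<le> k * d) \<Longrightarrow>
        disjoint_family_on (\<lambda>(a, b). {a<..<b}) P \<Longrightarrow>
        (\<Sum>(a, b)\<in>P. b - a) < \<delta> \<Longrightarrow> (\<Sum>(a, b)\<in>P. norm (x b - x a)) < e"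
    using ac unfolding abs_cont_on_segment_def by meson
  show "\<exists>\<delta>>0. \<forall>P. finite P \<longrightarrow>
        (\<forall>(a, b)\<in>P. c \<le> a \<and> a \<le> b \<and> b \<le> d) \<longrightarrow>
        disjoint_family_on (\<lambda>(a, b). {a<..<b}) P \<longrightarrow>
        (\<Sum>(a, b)\<in>P. b - a) < \<delta> \<longrightarrow> (\<Sum>(a, b)\<in>P. norm (x (k * b) - x (k * a))) < e"
  proof (intro exI[of _ "\<delta> / k"] conjI allI impI)
    show "\<delta> / k > 0" using \<open>\<delta> > 0\<close> k by simp
    fix P :: "(real \<times> real) set"
    assume P: "finite P" "\<forall>(a, b)\<in>P. c \<le> a \<and> a \<le> b \<and> b \<le> d"
      "disjoint_family_on (\<lambda>(a, b). {a<..<b}) P" "(\<Sum>(a, b)\<in>P. b - a) < \<delta> / k"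
    define h where "h = (\<lambda>(a::real, b::real). (k * a, k * b))"
    have inj: "inj_on h P" using k by (auto simp: h_def inj_on_def)
    have "(\<Sum>(a, b)\<in>h ` P. norm (x b - x a)) < e"
    proof (rule \<delta>)
      show "finite (h ` P)" using P(1) by simp
      show "\<forall>(a, b)\<in>h ` P. k * c \<le> a \<and> a \<le> b \<and> b \<le> k * d"
        using P(2) k by (auto simp: h_def)
      show "disjoint_family_on (\<lambda>(a, b). {a<..<b}) (h ` P)"
        unfolding disjoint_family_on_def
      proof (intro ballI impI)
        fix p q assume "p \<in> h ` P" "q \<in> h ` P" "p \<noteq> q"
        then obtain a b a' b' where
          pq: "p = (k * a, k * b)" "q = (k * a', k * b')" and "(a, b) \<in> P" "(a', b') \<in> P"
          by (auto simp: h_def)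
        with \<open>p \<noteq> q\<close> P(3) have dis: "{a<..<b} \<inter> {a'<..<b'} = {}"
          unfolding disjoint_family_on_def by fastforce
        have "z / k \<in> {a<..<b} \<inter> {a'<..<b'}"
          if "z \<in> {k * a<..<k * b} \<inter> {k * a'<..<k * b'}" for z
          using that k by (auto simp: field_simps)
        then show "(case p of (a, b) \<Rightarrow> {a<..<b}) \<inter> (case q of (a, b) \<Rightarrow> {a<..<b}) = {}"
          unfolding pq prod.case using dis by (metis equals0I empty_iff)
      qed
      have "(\<Sum>(a, b)\<in>h ` P. b - a) = (\<Sum>(a, b)\<in>P. k * (b - a))"
        by (subst sum.reindex[OF inj]) (auto intro!: sum.cong simp: h_def algebra_simps)
      also have "\<dots> = k * (\<Sum>(a, b)\<in>P. b - a)"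
        by (simp add: sum_distrib_left case_prod_unfold)
      also have "\<dots> < \<delta>" using P(4) k by (simp add: field_simps)
      finally show "(\<Sum>(a, b)\<in>h ` P. b - a) < \<delta>" .
    qed
    also have "(\<Sum>(a, b)\<in>h ` P. norm (x b - x a)) = (\<Sum>(a, b)\<in>P. norm (x (k * b) - x (k * a)))"
      by (subst sum.reindex[OF inj]) (auto intro!: sum.cong simp: h_def)
    finally show "(\<Sum>(a, b)\<in>P. norm (x (k * b) - x (k * a))) < e" .
  qed
qed

section \<open>Locally Lipschitz functions and their composition with curves\<close>

text \<open>The single constant comes from a compactness theorem on time-dependent families, applied
  to \<open>f\<close> as a constant family over the one-point time set \<open>{0}\<close>.\<close>

lemma locally_lipschitz_imp_lipschitz_on_compact:
  fixes f :: "'a::metric_space \<Rightarrow> 'b::metric_space"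
  assumes "locally_lipschitz f" "compact K"
  obtains L where "L-lipschitz_on K f"
proof -
  have "local_lipschitz {0::real} K (\<lambda>_. f)"
  proof (rule local_lipschitzI)
    fix t :: real and x assume "x \<in> K"
    from assms(1) obtain r L where "r > 0" and L: "L-lipschitz_on (ball x r) f"
      unfolding locally_lipschitz_def by meson
    \<comment> \<open>\<open>local_lipschitz\<close> asks for closed balls; half the radius fits one
      into the open ball.\<close>
    have "L-lipschitz_on (cball x (r / 2) \<inter> K) f"
      by (rule lipschitz_on_subset[OF L]) (use \<open>r > 0\<close> in auto)
    with \<open>r > 0\<close> show "\<exists>u>0. \<exists>L. \<forall>t\<in>cball t u \<inter> {0}. L-lipschitz_on (cball x u \<inter> K) f"
      by (intro exI[of _ "r / 2"]) auto
  qed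
  from local_lipschitz_compact_implies_lipschitz[OF this assms(2)]
  show ?thesis using that by (metis compact_sing continuous_on_const singletonI)
qed

lemma locally_lipschitz_imp_continuous_on:
  assumes "locally_lipschitz f"
  shows "continuous_on S f"
proof -
  have "isCont f x" for x
  proof -
    from assms obtain r L where "r > 0" "L-lipschitz_on (ball x r) f"
      unfolding locally_lipschitz_def by meson
    then have "continuous_on (ball x r) f" by (simp add: lipschitz_on_continuous_on)
    with \<open>r > 0\<close> show ?thesis
      by (simp add: continuous_on_eq_continuous_at)
  qed
  then show ?thesis by (simp add: continuous_at_imp_continuous_on)
qed

text \<open>With one Lipschitz constant on the whole image, every increment grows by at most the
  same factor, wherever its interval lies.\<close>

lemma abs_cont_on_segment_lipschitz_compose:
  fixes x :: "real \<Rightarrow> 'a::real_normed_vector" and f :: "'a \<Rightarrow> 'b::real_normed_vector"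
  assumes ac: "abs_cont_on_segment c d x" and L: "L-lipschitz_on (x ` {c..d}) f"
  shows "abs_cont_on_segment c d (f \<circ> x)"
  unfolding abs_cont_on_segment_def
proof (intro allI impI)
  fix e :: real assume e: "e > 0"
  have L0: "L \<ge> 0" using L by (rule lipschitz_on_nonneg)
  \<comment> \<open>Dividing by \<open>L + 1\<close> instead of \<open>L\<close> covers the case
    \<open>L = 0\<close>.\<close>
  then have "e / (L + 1) > 0" using e by simp
  then obtain \<delta> where "\<delta> > 0" and \<delta>: "\<And>P. finite P \<Longrightarrow>
        (\<forall>(a, b)\<in>P. c \<le> a \<and> a \<le> b \<and> b \<le> d) \<Longrightarrow>
        disjoint_family_on (\<lambda>(a, b). {a<..<b}) P \<Longrightarrow>
        (\<Sum>(a, b)\<in>P. b - a) < \<delta> \<Longrightarrow> (\<Sum>(a, b)\<in>P. norm (x b - x a)) < e / (L + 1)"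
    using ac unfolding abs_cont_on_segment_def by meson
  show "\<exists>\<delta>>0. \<forall>P. finite P \<longrightarrow>
        (\<forall>(a, b)\<in>P. c \<le> a \<and> a \<le> b \<and> b \<le> d) \<longrightarrow>
        disjoint_family_on (\<lambda>(a, b). {a<..<b}) P \<longrightarrow>
        (\<Sum>(a, b)\<in>P. b - a) < \<delta> \<longrightarrow> (\<Sum>(a, b)\<in>P. norm ((f \<circ> x) b - (f \<circ> x) a)) < e"
  proof (intro exI[of _ \<delta>] conjI \<open>\<delta> > 0\<close> allI impI)
    fix P :: "(real \<times> real) set"
    assume P: "finite P" "\<forall>(a, b)\<in>P. c \<le> a \<and> a \<le> b \<and> b \<le> d"
      "disjoint_family_on (\<lambda>(a, b). {a<..<b}) P" "(\<Sum>(a, b)\<in>P. b - a) < \<delta>"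
    have "(\<Sum>(a, b)\<in>P. norm ((f \<circ> x) b - (f \<circ> x) a)) \<le> (\<Sum>(a, b)\<in>P. (L + 1) * norm (x b - x a))"
    proof (rule sum_mono, clarify)
      fix a b assume "(a, b) \<in> P"
      then have "x a \<in> x ` {c..d}" "x b \<in> x ` {c..d}" using P(2) by fastforce+
      then have "norm (f (x b) - f (x a)) \<le> L * norm (x b - x a)"
        using lipschitz_onD[OF L] by (simp add: dist_norm)
      also have "\<dots> \<le> (L + 1) * norm (x b - x a)" by (simp add: mult_right_mono)
      finally show "norm ((f \<circ> x) b - (f \<circ> x) a) \<le> (L + 1) * norm (x b - x a)" by simp
    qed
    also have "\<dots> = (L + 1) * (\<Sum>(a, b)\<in>P. norm (x b - x a))"
      by (simp add: sum_distrib_left case_prod_unfold)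
    also have "\<dots> < e" using \<delta>[OF P] L0 by (simp add: field_simps)
    finally show "(\<Sum>(a, b)\<in>P. norm ((f \<circ> x) b - (f \<circ> x) a)) < e" .
  qed
qed

section \<open>Monotonicity from an almost everywhere nonpositive derivative\<close>

text \<open>A straddle estimate: as \<open>u\<close> and \<open>v\<close> lie on opposite sides of
  \<open>t\<close>, the two linearization errors add up to at most \<open>\<eta> * (v - u)\<close>,
  while the linear part \<open>g' * (v - u)\<close> is nonpositive.\<close>

lemma nonpos_derivative_local_upper_bound:
  fixes g :: "real \<Rightarrow> real"
  assumes "(g has_real_derivative g') (at t)" "g' \<le> 0" "\<eta> > 0"
  shows "\<exists>r>0. \<forall>u\<in>ball t r. \<forall>v\<in>ball t r. u \<le> t \<longrightarrow> t \<le> v \<longrightarrow> g v - g u \<le> \<eta> * (v - u)"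
proof -
  from assms(1) have "(g has_derivative (\<lambda>h. g' * h)) (at t)"
    by (simp add: has_field_derivative_def)
  then obtain r where "r > 0" and
    r: "\<And>s. norm (s - t) < r \<Longrightarrow> norm (g s - g t - g' * (s - t)) \<le> \<eta> * norm (s - t)"
    using \<open>\<eta> > 0\<close> unfolding has_derivative_at_alt by meson
  show ?thesis
  proof (intro exI[of _ r] conjI \<open>r > 0\<close> ballI impI)
    fix u v assume uv: "u \<in> ball t r" "v \<in> ball t r" "u \<le> t" "t \<le> v"
    have "\<bar>g u - g t - g' * (u - t)\<bar> \<le> \<eta> * (t - u)"
      using r[of u] uv by (simp add: dist_real_def)
    moreover have "\<bar>g v - g t - g' * (v - t)\<bar> \<le> \<eta> * (v - t)"
      using r[of v] uv by (simp add: dist_real_def)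
    moreover have "g' * (u - t) \<ge> 0" using assms(2) uv by (simp add: mult_nonpos_nonpos)
    moreover have "g' * (v - t) \<le> 0" using assms(2) uv by (simp add: mult_nonpos_nonneg)
    ultimately show "g v - g u \<le> \<eta> * (v - u)" by (simp add: algebra_simps)
  qed
qed

text \<open>Cousin's lemma provides a tagged division whose tags off the null set carry increments at
  most \<open>\<eta>\<close> times the length, while the intervals tagged in the null set lie in an open set of
  small measure, so that absolute continuity bounds their total increment.\<close>
lemma abs_cont_nonpos_derivative_imp_le:
  fixes g :: "real \<Rightarrow> real"
  assumes ac: "abs_cont_on_segment c d g" and cd: "c \<le> d" and N: "negligible N"
    and deriv: "\<And>t. t \<in> {c<..<d} - N \<Longrightarrow> \<exists>g'\<le>0. (g has_real_derivative g') (at t)"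
  shows "g d \<le> g c"
proof -
  \<comment> \<open>\<open>e\<close> pays for the intervals tagged in the null set,
    \<open>\<eta>\<close> is the slope allowed elsewhere; both are made arbitrarily small at the
    end.\<close>
  have key: "g d - g c \<le> e + \<eta> * (d - c)" if e: "e > 0" and eta: "\<eta> > 0" for e \<eta>
  proof -
    from ac e obtain \<delta> where "\<delta> > 0" and \<delta>: "\<And>P. finite P \<Longrightarrow>
          (\<forall>(a, b)\<in>P. c \<le> a \<and> a \<le> b \<and> b \<le> d) \<Longrightarrow>
          disjoint_family_on (\<lambda>(a, b). {a<..<b}) P \<Longrightarrow>
          (\<Sum>(a, b)\<in>P. b - a) < \<delta> \<Longrightarrow> (\<Sum>(a, b)\<in>P. norm (g b - g a)) < e"
      unfolding abs_cont_on_segment_def by meson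
    \<comment> \<open>Derivatives are given only inside the open interval, so the endpoints join the
      exceptional set.\<close>
    define M where "M = insert c (insert d N)"
    have M: "M \<in> null_sets lebesgue"
      using N by (simp add: M_def negligible_iff_null_sets[symmetric])
    then obtain U where U: "open U" "M \<subseteq> U" "U - M \<in> lmeasurable"
        "emeasure lebesgue (U - M) < ennreal \<delta>"
      using sets_lebesgue_outer_open[OF null_setsD2[OF M] \<open>\<delta> > 0\<close>] by metis
    have Uem: "emeasure lebesgue U < ennreal \<delta>"
      using U(1,4) emeasure_Diff_null_set[OF M, of U] by simp
    define good where "good t r \<longleftrightarrow> r > 0 \<and> (\<forall>u\<in>ball t r. \<forall>v\<in>ball t r.
        u \<le> t \<longrightarrow> t \<le> v \<longrightarrow> g v - g u \<le> \<eta> * (v - u))" for t r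
    \<comment> \<open>An interval tagged in \<open>M\<close> is forced into the small set
      \<open>U\<close>; at other tags the straddle estimate applies. Tags lie in
      \<open>{c..d}\<close>, and \<open>UNIV\<close> is the default value at the remaining
      points.\<close>
    define \<gamma> where "\<gamma> t = (if t \<in> M then U else if t \<in> {c..d} then ball t (SOME r. good t r)
        else UNIV)" for t
    have good: "good t (SOME r. good t r)" if "t \<in> {c..d}" "t \<notin> M" for t
    proof -
      from that have "t \<in> {c<..<d} - N" by (auto simp: M_def)
      from deriv[OF this] have "\<exists>r. good t r"
        unfolding good_def using nonpos_derivative_local_upper_bound eta by meson
      then show ?thesis by (rule someI_ex)
    qed
    have "gauge \<gamma>"
      using U(1,2) good by (auto simp: gauge_def \<gamma>_def good_def)
    then obtain p where p: "p tagged_division_of {c..d}" "\<gamma> fine p"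
      by (rule fine_division_exists_real)
    have fin: "finite p" using p(1) by (rule tagged_division_of_finite)
    have K: "K = {Inf K..Sup K} \<and> Inf K \<le> t \<and> t \<le> Sup K \<and> c \<le> Inf K \<and> Sup K \<le> d
        \<and> K \<subseteq> \<gamma> t" if tK: "(t, K) \<in> p" for t K
    proof -
      obtain a b where "K = {a..b}" using tagged_division_ofD(4)[OF p(1) tK] by auto
      moreover have "t \<in> K" "K \<subseteq> {c..d}" using tagged_division_ofD(2,3)[OF p(1) tK] by auto
      moreover have "K \<subseteq> \<gamma> t" using p(2) tK by (auto simp: fine_def)
      ultimately show ?thesis by auto
    qed
    define Q where "Q = {(t, K) \<in> p. t \<in> M}"
    have Qp: "Q \<subseteq> p" by (auto simp: Q_def)
    have finQ: "finite Q" using fin Qp by (rule rev_finite_subset)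
    \<comment> \<open>Forgetting the tags turns tagged intervals into the endpoint pairs of
      \<open>abs_cont_on_segment\<close>.\<close>
    define h where "h = (\<lambda>(t::real, K::real set). (Inf K, Sup K))"
    have box_disj: "{Inf K<..<Sup K} \<inter> {Inf K'<..<Sup K'} = {}"
      if "(t, K) \<in> p" "(t', K') \<in> p" "(t, K) \<noteq> (t', K')" for t K t' K'
    proof -
      have "interior {Inf K..Sup K} \<inter> interior {Inf K'..Sup K'} = {}"
        using tagged_division_ofD(5)[OF p(1) that] K[OF that(1)] K[OF that(2)] by metis
      then show ?thesis by simp
    qed
    have "(\<Sum>(a, b)\<in>h ` Q. norm (g b - g a)) < e"
    proof (rule \<delta>)
      show "finite (h ` Q)" using finQ by simp
      show "\<forall>(a, b)\<in>h ` Q. c \<le> a \<and> a \<le> b \<and> b \<le> d"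
        using K Qp by (force simp: h_def)
      show dis: "disjoint_family_on (\<lambda>(a, b). {a<..<b}) (h ` Q)"
        unfolding disjoint_family_on_def
      proof (intro ballI impI)
        fix q q'
        assume "q \<in> h ` Q" "q' \<in> h ` Q" "q \<noteq> q'"
        obtain t K where "(t, K) \<in> p" and q: "q = (Inf K, Sup K)"
          using \<open>q \<in> h ` Q\<close> Qp by (auto simp: h_def)
        moreover obtain t' K' where "(t', K') \<in> p" and q': "q' = (Inf K', Sup K')"
          using \<open>q' \<in> h ` Q\<close> Qp by (auto simp: h_def)
        moreover have "(t, K) \<noteq> (t', K')" using \<open>q \<noteq> q'\<close> q q' by auto
        ultimately show "(case q of (a, b) \<Rightarrow> {a<..<b}) \<inter> (case q' of (a, b) \<Rightarrow> {a<..<b}) = {}"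
          using box_disj q q' by simp
      qed
      have le: "a \<le> b" "{a<..<b} \<subseteq> U" if "(a, b) \<in> h ` Q" for a b
      proof -
        from that obtain t K where "(t, K) \<in> p" "t \<in> M" "a = Inf K" "b = Sup K"
          by (auto simp: h_def Q_def)
        with K[of t K] have "a \<le> b" "{a..b} \<subseteq> U" by (auto simp: \<gamma>_def)
        then show "a \<le> b" "{a<..<b} \<subseteq> U" by auto
      qed
      \<comment> \<open>The total length is the measure of a disjoint union of open intervals
        contained in \<open>U\<close>.\<close>
      have "ennreal (\<Sum>(a, b)\<in>h ` Q. b - a) = (\<Sum>q\<in>h ` Q. ennreal (case q of (a, b) \<Rightarrow> b - a))"
        using le(1) by (subst sum_ennreal) auto
      also have "\<dots> = (\<Sum>q\<in>h ` Q. emeasure lebesgue (case q of (a, b) \<Rightarrow> {a<..<b}))"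
        using le(1) by (intro sum.cong) (auto simp: case_prod_unfold)
      also have "\<dots> = emeasure lebesgue (\<Union>q\<in>h ` Q. case q of (a, b) \<Rightarrow> {a<..<b})"
        by (rule sum_emeasure[OF _ dis]) (use finQ in auto)
      also have "\<dots> \<le> emeasure lebesgue U"
      proof (intro emeasure_mono UN_least)
        show "(case q of (a, b) \<Rightarrow> {a<..<b}) \<subseteq> U" if "q \<in> h ` Q" for q
          using le(2)[of "fst q" "snd q"] that by (simp add: case_prod_unfold)
      qed (use U(1) in auto)
      also have "\<dots> < ennreal \<delta>" by (rule Uem)
      finally show "(\<Sum>(a, b)\<in>h ` Q. b - a) < \<delta>"
        using \<open>\<delta> > 0\<close> by (simp add: ennreal_less_iff sum_nonneg le(1) case_prod_unfold)
    qed
    \<comment> \<open>If distinct members of \<open>Q\<close> had the same endpoints, disjointness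
      would make their common open interval empty and the increment zero, so the sum transfers back
      to \<open>Q\<close>.\<close>
    also have "(\<Sum>(a, b)\<in>h ` Q. norm (g b - g a)) = (\<Sum>(t, K)\<in>Q. norm (g (Sup K) - g (Inf K)))"
    proof (subst sum.reindex_nontrivial[OF finQ])
      fix q q' assume qq: "q \<in> Q" "q' \<in> Q" "q \<noteq> q'" "h q = h q'"
      obtain t K t' K' where tK: "q = (t, K)" "q' = (t', K')" by fastforce
      with qq box_disj[of t K t' K'] Qp have "{Inf K<..<Sup K} = {}" by (auto simp: h_def)
      moreover have "Inf K \<le> Sup K" using K[of t K] qq(1) tK Qp by auto
      ultimately have "Inf K = Sup K" by simp
      then show "(case h q of (a, b) \<Rightarrow> norm (g b - g a)) = 0" by (simp add: tK h_def)
    qed (auto intro!: sum.cong simp: h_def)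
    finally have bad: "(\<Sum>(t, K)\<in>Q. norm (g (Sup K) - g (Inf K))) < e" .
    \<comment> \<open>The increments telescope over the division.\<close>
    have "g d - g c = (\<Sum>(t, K)\<in>p. g (Sup K) - g (Inf K))"
      using additive_tagged_division_1[OF cd p(1), of g] by simp
    \<comment> \<open>The slope term is charged to all intervals, including those tagged in
      \<open>M\<close>, so that its sum is exactly \<open>\<eta> * (d - c)\<close>.\<close>
    also have "\<dots> \<le> (\<Sum>(t, K)\<in>p. (if t \<in> M then norm (g (Sup K) - g (Inf K)) else 0)
        + \<eta> * (Sup K - Inf K))"
    proof (rule sum_mono, clarify)
      fix t K assume tK: "(t, K) \<in> p"
      note KK = K[OF tK]
      show "g (Sup K) - g (Inf K) \<le> (if t \<in> M then norm (g (Sup K) - g (Inf K)) else 0)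
          + \<eta> * (Sup K - Inf K)"
      proof (cases "t \<in> M")
        case True
        have "\<eta> * (Sup K - Inf K) \<ge> 0" using eta KK by simp
        with True show ?thesis by simp
      next
        case False
        have t: "t \<in> {c..d}" using KK by auto
        have "Inf K \<in> K" "Sup K \<in> K" using KK by (metis atLeastAtMost_iff order.trans order.refl)+
        with KK t False have "Inf K \<in> ball t (SOME r. good t r)" "Sup K \<in> ball t (SOME r. good t r)"
          by (auto simp: \<gamma>_def)
        then show ?thesis using good[OF t False] KK False by (auto simp: good_def)
      qed
    qed
    also have "\<dots> = (\<Sum>(t, K)\<in>Q. norm (g (Sup K) - g (Inf K))) + \<eta> * (\<Sum>(t, K)\<in>p. Sup K - Inf K)"
      using fin unfolding Q_def real_norm_def
      by (simp add: case_prod_unfold sum.distrib sum_distrib_left sum.inter_filter)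
    also have "(\<Sum>(t, K)\<in>p. Sup K - Inf K) = d - c"
      using additive_tagged_division_1[OF cd p(1), of "\<lambda>t. t"] by simp
    finally show ?thesis using bad by simp
  qed
  show ?thesis
  proof (rule field_le_epsilon)
    fix e :: real assume e: "e > 0"
    \<comment> \<open>The summand 1 keeps the denominator positive when
      \<open>c = d\<close>.\<close>
    have "e / 2 / (d - c + 1) * (d - c) \<le> e / 2"
      using cd e by (simp add: field_simps)
    moreover have "g d - g c \<le> e / 2 + e / 2 / (d - c + 1) * (d - c)"
      using e cd by (intro key) auto
    ultimately show "g d \<le> g c + e" by linarith
  qed
qed

section \<open>Decrease of the potential along solutions\<close>

text \<open>\<open>LEAST\<close> is meaningful only when a least element exists; compactness
  supplies one.\<close>

lemma minimum_attained:
  assumes "compact S" "S \<noteq> {}"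
  shows "minimum S \<in> S"
proof -
  obtain m where "m \<in> S" "\<forall>s\<in>S. m \<le> s" using compact_attains_inf[OF assms] by blast
  then have "minimum S = m" unfolding minimum_def by (intro Least_equality) auto
  with \<open>m \<in> S\<close> show ?thesis by simp
qed

lemma solution_on_imp_abs_cont_on_segment:
  assumes "solution_on F T x" "0 \<le> \<tau>" "ereal \<tau> < T"
  shows "abs_cont_on_segment 0 \<tau> x"
proof -
  have "{0..\<tau>} \<subseteq> {t. 0 \<le> t \<and> ereal t < T}"
    using assms(3) by (auto intro: le_less_trans[of _ "ereal \<tau>"])
  with assms(1,2) show ?thesis unfolding solution_on_def abs_cont_on_def by blast
qed

text \<open>Time is rescaled to the unit interval, where the defining property of \<open>D\<close>
  applies. Off the exceptional sets of that property and of the inclusion, the potential has a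
  nonpositive derivative, and absolute continuity turns this into the inequality.\<close>

lemma potential_le_along_solution:
  fixes F D :: "'a::euclidean_space \<Rightarrow> 'a set"
  assumes D: "conservative_field D f"
    and sup: "\<And>x. (SUP u\<in>F x. ereal (minimum ((\<lambda>v. u \<bullet> v) ` D x))) \<le> 0"
    and sol: "solution_on F T x" and \<tau>: "0 \<le> \<tau>" "ereal \<tau> < T"
  shows "f (x \<tau>) \<le> f (x 0)"
proof (cases "\<tau> = 0")
  case False
  with \<tau> have tau: "\<tau> > 0" by simp
  have less_T: "ereal t < T" if "t \<le> \<tau>" for t
    using that \<tau>(2) by (meson ereal_less_eq(3) le_less_trans)
  have "abs_cont_on_segment 0 \<tau> x"
    using sol \<tau> by (rule solution_on_imp_abs_cont_on_segment)
  define y where "y = (\<lambda>s. x (\<tau> * s))"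
  have acy: "abs_cont_on_segment 0 1 y"
    unfolding y_def using \<open>abs_cont_on_segment 0 \<tau> x\<close> tau
    by (intro abs_cont_on_segment_rescale) auto
  have "abs_cont_on {0..1} y"
    unfolding abs_cont_on_def using abs_cont_on_segment_subset[OF acy] by auto
  with D have "AE s in lebesgue. s \<in> {0<..<1} \<longrightarrow> (\<exists>y'. (y has_vector_derivative y') (at s) \<and>
      (\<forall>v\<in>D (y s). ((f \<circ> y) has_real_derivative (v \<bullet> y')) (at s)))"
    unfolding conservative_field_def by blast
  then obtain N1 where N1: "negligible N1" and
    der: "\<And>s. s \<notin> N1 \<Longrightarrow> s \<in> {0<..<1} \<Longrightarrow> \<exists>y'. (y has_vector_derivative y') (at s) \<and>
      (\<forall>v\<in>D (y s). ((f \<circ> y) has_real_derivative (v \<bullet> y')) (at s))"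
    unfolding eventually_ae_filter_negligible by blast
  obtain N2 where N2: "negligible N2" and
    inF: "\<And>t. t \<notin> N2 \<Longrightarrow> 0 < t \<Longrightarrow> ereal t < T \<Longrightarrow>
      \<exists>x'. (x has_vector_derivative x') (at t) \<and> x' \<in> F (x t)"
    using sol unfolding solution_on_def eventually_ae_filter_negligible by blast
  \<comment> \<open>The exceptional times of \<open>x\<close> are moved to the time scale of
    \<open>y\<close>; a differentiable map sends null sets to null sets.\<close>
  have N2': "negligible ((\<lambda>t. t / \<tau>) ` N2)"
    by (rule negligible_differentiable_image_negligible[OF _ N2])
      (use tau in \<open>auto intro!: derivative_intros differentiable_at_imp_differentiable_on\<close>)
  have "compact (y ` {0..1})"
    using abs_cont_on_segment_imp_continuous_on[OF acy] by (rule compact_continuous_image) simp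
  then obtain L where L: "L-lipschitz_on (y ` {0..1}) f"
    using locally_lipschitz_imp_lipschitz_on_compact D unfolding conservative_field_def by metis
  have "(f \<circ> y) 1 \<le> (f \<circ> y) 0"
  proof (rule abs_cont_nonpos_derivative_imp_le[where g = "f \<circ> y" and c = 0 and d = 1])
    show "abs_cont_on_segment 0 1 (f \<circ> y)"
      using acy L by (rule abs_cont_on_segment_lipschitz_compose)
    show "negligible (N1 \<union> (\<lambda>t. t / \<tau>) ` N2)" using N1 N2' by (rule negligible_Un)
    fix s assume s: "s \<in> {0<..<1} - (N1 \<union> (\<lambda>t. t / \<tau>) ` N2)"
    obtain y' where y': "(y has_vector_derivative y') (at s)" and
      cons: "\<And>v. v \<in> D (y s) \<Longrightarrow> ((f \<circ> y) has_real_derivative (v \<bullet> y')) (at s)"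
      using der s by blast
    have "\<tau> * s \<notin> N2" using s tau by (auto simp: image_iff)
    moreover have "0 < \<tau> * s" "\<tau> * s \<le> \<tau>" using s tau by auto
    ultimately obtain x' where x': "(x has_vector_derivative x') (at (\<tau> * s))" "x' \<in> F (y s)"
      using inF less_T y_def by meson
    \<comment> \<open>The velocity \<open>y'\<close> comes from the conservative field and
      \<open>x'\<close> from the inclusion; the chain rule and uniqueness of derivatives tie them
      together.\<close>
    have "((x \<circ> (\<lambda>s. \<tau> * s)) has_vector_derivative \<tau> *\<^sub>R x') (at s)"
      by (rule vector_diff_chain_at)
        (use x'(1) in \<open>auto intro!: derivative_eq_intros\<close>)
    then have "(y has_vector_derivative \<tau> *\<^sub>R x') (at s)" by (simp add: y_def o_def)
    with y' have y'_eq: "y' = \<tau> *\<^sub>R x'" by (rule vector_derivative_unique_at)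
    have "compact ((\<lambda>v. x' \<bullet> v) ` D (y s))" "(\<lambda>v. x' \<bullet> v) ` D (y s) \<noteq> {}"
      using D unfolding conservative_field_def
      by (auto intro!: compact_continuous_image continuous_intros)
    \<comment> \<open>Every element of \<open>D (y s)\<close> represents the derivative of
      \<open>f \<circ> y\<close>, so the minimizing one may be chosen. Its product with
      \<open>x'\<close> is a term of the supremum, because \<open>x'\<close> lies in
      \<open>F (y s)\<close>.\<close>
    then obtain v where v: "v \<in> D (y s)" "minimum ((\<lambda>v. x' \<bullet> v) ` D (y s)) = x' \<bullet> v"
      using minimum_attained by blast
    have "x' \<bullet> v \<le> 0"
      using sup[of "y s"] x'(2) v(2) by (auto simp: SUP_le_iff)
    then have "v \<bullet> y' \<le> 0" using tau by (simp add: y'_eq inner_commute mult_nonneg_nonpos)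
    with cons[OF v(1)] show "\<exists>g'\<le>0. ((f \<circ> y) has_real_derivative g') (at s)" by blast
  qed simp
  then show ?thesis by (simp add: y_def)
qed simp

section \<open>A sphere that solutions starting near the minimum cannot reach\<close>

theorem theorem1p1:
  fixes xb :: "real ^ 'n"
    and F D :: "real ^ 'n \<Rightarrow> (real ^ 'n) set"
    and f :: "real ^ 'n \<Rightarrow> real"
  assumes "conservative_field D f"
    and "\<And>x. (SUP u\<in>F x. ereal (minimum ((\<lambda>v. u \<bullet> v) ` D x))) \<le> 0"
    and "strict_local_minimum f xb"
  shows "lyapunov_stable F xb"
  unfolding lyapunov_stable_def
proof (intro allI impI)
  fix \<epsilon> :: real assume "\<epsilon> > 0"
  obtain r where "r > 0" and r: "\<And>x. x \<in> ball xb r \<Longrightarrow> x \<noteq> xb \<Longrightarrow> f xb < f x"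
    using assms(3) unfolding strict_local_minimum_def by blast
  \<comment> \<open>Half of \<open>r\<close> keeps the sphere inside the open ball where the minimum
    is strict.\<close>
  define \<rho> where "\<rho> = min \<epsilon> (r / 2)"
  have \<rho>: "\<rho> > 0" "\<rho> \<le> \<epsilon>" "\<rho> < r" using \<open>\<epsilon> > 0\<close> \<open>r > 0\<close> by (auto simp: \<rho>_def)
  have f_cont: "continuous_on S f" for S
    using assms(1) unfolding conservative_field_def by (simp add: locally_lipschitz_imp_continuous_on)
  \<comment> \<open>The index type \<open>'n\<close> is nonempty, so the dimension is positive and
    the sphere has points.\<close>
  have "sphere xb \<rho> \<noteq> {}" using \<rho>(1) by simp
  then obtain z where z: "z \<in> sphere xb \<rho>" "\<And>w. w \<in> sphere xb \<rho> \<Longrightarrow> f z \<le> f w"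
    using continuous_attains_inf[OF compact_sphere _ f_cont] by metis
  have "f xb < f z" using r[of z] z(1) \<rho> by auto
  moreover have "isCont f xb" using f_cont[of UNIV] by (simp add: continuous_on_eq_continuous_at)
  ultimately obtain \<delta>0 where "\<delta>0 > 0" and \<delta>0: "\<And>w. dist w xb < \<delta>0 \<Longrightarrow> f w < f z"
    unfolding continuous_at_eps_delta
    by (metis dist_real_def abs_diff_less_iff add.commute diff_gt_0_iff_gt diff_add_cancel)
  \<comment> \<open>\<open>\<delta>0\<close> keeps the initial potential below the barrier level
    \<open>f z\<close>; \<open>\<rho>\<close> places the starting point inside the sphere, as the
    intermediate value theorem requires.\<close>
  define \<delta> where "\<delta> = min \<delta>0 \<rho>"
  show "\<exists>\<delta>>0. \<forall>(T::ereal) x. 0 < T \<longrightarrow> solution_on F T x \<longrightarrow>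
        x 0 \<in> ball xb \<delta> \<longrightarrow> x ` {t. 0 \<le> t \<and> ereal t < T} \<subseteq> ball xb \<epsilon>"
  proof (intro exI[of _ \<delta>] conjI allI impI)
    show "\<delta> > 0" using \<open>\<delta>0 > 0\<close> \<rho>(1) by (simp add: \<delta>_def)
    fix T :: ereal and x
    assume sol: "solution_on F T x" and x0: "x 0 \<in> ball xb \<delta>"
    have "x t \<in> ball xb \<rho>" if t: "0 \<le> t" "ereal t < T" for t
    proof (rule ccontr)
      assume out: "x t \<notin> ball xb \<rho>"
      have less_T: "ereal s < T" if "s \<le> t" for s
        using that t(2) by (meson ereal_less_eq(3) le_less_trans)
      have "abs_cont_on_segment 0 t x"
        using sol t by (rule solution_on_imp_abs_cont_on_segment)
      then have "continuous_on {0..t} (\<lambda>s. dist xb (x s))"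
        by (intro continuous_intros abs_cont_on_segment_imp_continuous_on)
      moreover have "dist xb (x 0) \<le> \<rho>" "\<rho> \<le> dist xb (x t)"
        using x0 out by (auto simp: \<delta>_def)
      \<comment> \<open>At the crossing time \<open>s\<close> the potential is at least
        \<open>f z\<close>, although it cannot exceed its initial value, which is below
        \<open>f z\<close>.\<close>
      ultimately obtain s where s: "0 \<le> s" "s \<le> t" "dist xb (x s) = \<rho>"
        using IVT'[of "\<lambda>s. dist xb (x s)" 0 \<rho> t] t(1) by blast
      have "f z \<le> f (x s)" using z(2) s(3) by simp
      also have "\<dots> \<le> f (x 0)"
        using potential_le_along_solution[OF assms(1,2) sol s(1) less_T[OF s(2)]] .
      also have "\<dots> < f z" using x0 by (intro \<delta>0) (simp add: \<delta>_def dist_commute)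
      finally show False by simp
    qed
    then show "x ` {t. 0 \<le> t \<and> ereal t < T} \<subseteq> ball xb \<epsilon>" using \<rho>(2) by force
  qed
qed

end
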